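(* Let $(S,*,{}')$ be an algebra of type $\langle 2,1\rangle$, i.e. a set $S$ with a binary operation $*$ (written as juxtaposition, $xy = x*y$) and a unary operation $x\mapsto x'$. Then $(S,* )$ is an inverse semigroup and the unary operation ${}'$ coincides with the usual inversion on this inverse semigroup if and only if the following three identities hold for all $x,y,z\in S$: $$x=(xx')x, \qquad (xx')(y'y)=(y'y)(xx'), \qquad (xy)z=x(yz''),$$ where $z''=(z')'$.
   Context: An inverse semigroup is a semigroup in which every element $x$ has a unique inverse, i.e. a unique element $y$ with $xyx=x$ and $yxy=y$; the usual inversion is the unary operation sending $x$ to this unique inverse $y$. In the three identities the binary operation is not assumed to be associative. *)

theory Defs
  imports Main
begin

definition inverse_pair :: "('a \<Rightarrow> 'a \<Rightarrow> 'a) \<Rightarrow> 'a \<Rightarrow> 'a \<Rightarrow> bool" where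
  "inverse_pair f x y \<longleftrightarrow> f (f x y) x = x \<and> f (f y x) y = y"

locale inverse_semigroup = semigroup f
  for f :: "'a \<Rightarrow> 'a \<Rightarrow> 'a" +
  assumes ex1_inverse: "\<exists>!y. inverse_pair f x y"

(* Meaningful only when inverse_semigroup f holds; otherwise the value may be arbitrary. *)
definition semigroup_inversion :: "('a \<Rightarrow> 'a \<Rightarrow> 'a) \<Rightarrow> 'a \<Rightarrow> 'a" where
  "semigroup_inversion f x = (THE y. inverse_pair f x y)"

end

theory Submission
  imports Defs
begin

text \<open>
  The identities first give \<open>x' x'' = x' x\<close>, then \<open>x''' = x'\<close>, so that the third identity
  is genuine associativity whenever its last factor is an inverse. This turns \<open>x y''\<close> into
  \<open>x y\<close>, hence the third identity into associativity, and commutation of \<open>x x'\<close> with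
  \<open>x'' x'\<close> then yields \<open>x'' = x\<close>. Now every idempotent \<open>e\<close> equals \<open>e e'\<close>, so idempotents
  commute and inverses are unique. Conversely, in an inverse semigroup the inverse of a product
  \<open>e f\<close> of idempotents is idempotent, hence its own inverse; so \<open>e f\<close> is idempotent, and
  \<open>f e\<close> is another inverse of it.
\<close>

context semigroup
begin

lemma inverse_unique_if_idempotents_commute:
  assumes comm: "\<And>e g. e \<^bold>* e = e \<Longrightarrow> g \<^bold>* g = g \<Longrightarrow> e \<^bold>* g = g \<^bold>* e"
    and y: "inverse_pair f x y" and z: "inverse_pair f x z"
  shows "y = z"
proof -
  have xyx: "x \<^bold>* (y \<^bold>* x) = x" and yxy: "y \<^bold>* (x \<^bold>* y) = y"
    and xzx: "x \<^bold>* (z \<^bold>* x) = x" and zxz: "z \<^bold>* (x \<^bold>* z) = z"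
    using y z by (simp_all add: inverse_pair_def assoc)
  have left: "(y \<^bold>* x) \<^bold>* (z \<^bold>* x) = (z \<^bold>* x) \<^bold>* (y \<^bold>* x)"
    by (rule comm) (simp_all add: assoc xyx xzx)
  have right: "(x \<^bold>* y) \<^bold>* (x \<^bold>* z) = (x \<^bold>* z) \<^bold>* (x \<^bold>* y)"
    by (rule comm) (metis assoc xyx, metis assoc xzx)
  have "y = (y \<^bold>* x) \<^bold>* y" using yxy by (simp add: assoc)
  \<comment> \<open>\<open>yx = (yx)(zx) = (zx)(yx) = zx\<close>; the case of \<open>xy\<close> is
    dual.\<close>
  also have "y \<^bold>* x = z \<^bold>* x" by (metis assoc left xyx xzx)
  also have "(z \<^bold>* x) \<^bold>* y = z \<^bold>* (x \<^bold>* y)" by (rule assoc)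
  also have "x \<^bold>* y = x \<^bold>* z" by (metis assoc right xyx xzx)
  finally show ?thesis by (simp add: zxz)
qed

end

context inverse_semigroup
begin

notation f (infixl "\<^bold>*" 70)

lemma inverse_pair_inversion: "inverse_pair f x (semigroup_inversion f x)"
  unfolding semigroup_inversion_def by (rule theI') (rule ex1_inverse)

lemma inverse_pair_unique: "inverse_pair f x y \<Longrightarrow> inverse_pair f x z \<Longrightarrow> y = z"
  using ex1_inverse by blast

lemma inversion_inversion: "semigroup_inversion f (semigroup_inversion f x) = x"
  by (rule inverse_pair_unique [OF inverse_pair_inversion])
    (use inverse_pair_inversion [of x] in \<open>simp add: inverse_pair_def\<close>)

lemma idempotent_mult:
  assumes e: "e \<^bold>* e = e" and g: "g \<^bold>* g = g"
  shows "(e \<^bold>* g) \<^bold>* (e \<^bold>* g) = e \<^bold>* g"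
proof -
  define x where "x = semigroup_inversion f (e \<^bold>* g)"
  have x: "inverse_pair f (e \<^bold>* g) x" unfolding x_def by (rule inverse_pair_inversion)
  have "e \<^bold>* (g \<^bold>* (x \<^bold>* (e \<^bold>* g))) = e \<^bold>* g" and xegx: "x \<^bold>* (e \<^bold>* (g \<^bold>* x)) = x"
    using x by (simp_all add: inverse_pair_def assoc)
  moreover have "e \<^bold>* (e \<^bold>* z) = e \<^bold>* z" "g \<^bold>* (g \<^bold>* z) = g \<^bold>* z"
    "x \<^bold>* (e \<^bold>* (g \<^bold>* (x \<^bold>* z))) = x \<^bold>* z" for z
    by (metis assoc e, metis assoc g, metis assoc xegx)
  \<comment> \<open>Sandwiching \<open>x\<close> between \<open>g\<close> and \<open>e\<close> gives
    a second inverse of \<open>eg\<close>, so uniqueness forces \<open>gxe = x\<close>.\<close>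
  ultimately have "inverse_pair f (e \<^bold>* g) (g \<^bold>* (x \<^bold>* e))"
    by (simp add: inverse_pair_def assoc)
  then have gxe: "g \<^bold>* (x \<^bold>* e) = x" by (rule inverse_pair_unique [OF _ x])
  \<comment> \<open>\<open>xx = (gxe)(gxe) = g(xegx)e = gxe = x\<close>.\<close>
  have xx: "x \<^bold>* x = x"
    by (metis assoc gxe xegx)
  have "inverse_pair f x (e \<^bold>* g)" using x by (simp add: inverse_pair_def)
  moreover have "inverse_pair f x x" by (simp add: inverse_pair_def xx)
  ultimately have "e \<^bold>* g = x" by (rule inverse_pair_unique)
  with xx show ?thesis by simp
qed

lemma idempotents_commute:
  assumes e: "e \<^bold>* e = e" and g: "g \<^bold>* g = g"
  shows "e \<^bold>* g = g \<^bold>* e"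
proof (rule inverse_pair_unique)
  show "inverse_pair f (e \<^bold>* g) (e \<^bold>* g)"
    by (simp add: inverse_pair_def idempotent_mult e g)
  have "e \<^bold>* (e \<^bold>* z) = e \<^bold>* z" "g \<^bold>* (g \<^bold>* z) = g \<^bold>* z" for z
    by (metis assoc e, metis assoc g)
  then show "inverse_pair f (e \<^bold>* g) (g \<^bold>* e)"
    using idempotent_mult [OF e g] idempotent_mult [OF g e]
    by (simp add: inverse_pair_def assoc)
qed

end

locale inversion_identities =
  fixes f :: "'a \<Rightarrow> 'a \<Rightarrow> 'a" (infixl "\<cdot>" 70)
    and i :: "'a \<Rightarrow> 'a"
  assumes regular: "(x \<cdot> i x) \<cdot> x = x"
    and commute: "(x \<cdot> i x) \<cdot> (i y \<cdot> y) = (i y \<cdot> y) \<cdot> (x \<cdot> i x)"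
    and twisted_assoc: "(x \<cdot> y) \<cdot> z = x \<cdot> (y \<cdot> i (i z))"
begin

text \<open>Two uses of \<open>twisted_assoc\<close> turn the right side into
  \<open>w((x''x''')x'')\<close>, which regularity at \<open>x''\<close> collapses.\<close>

lemma mult_i_i_expand: "w \<cdot> i (i x) = ((w \<cdot> i (i x)) \<cdot> i x) \<cdot> x"
  by (metis regular twisted_assoc)

lemma i_mult_i_i: "i x \<cdot> i (i x) = i x \<cdot> x"
  by (metis mult_i_i_expand regular)

lemma mult_i_mult: "(w \<cdot> i x) \<cdot> x = w \<cdot> (i x \<cdot> x)"
  by (simp add: twisted_assoc i_mult_i_i)

lemma i_regular: "(i x \<cdot> x) \<cdot> i x = i x"
  by (metis i_mult_i_i regular)

lemma i_i_regular: "(i (i x) \<cdot> i x) \<cdot> x = i (i x)"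
  by (metis mult_i_i_expand regular)

lemma i_mult_idem: "(i x \<cdot> x) \<cdot> (i x \<cdot> x) = i x \<cdot> x"
  by (metis i_regular mult_i_mult)

text \<open>Expand the first factor of \<open>x'''x\<close> as \<open>(x'''x'')x'''\<close>;
  \<open>twisted_assoc\<close> then produces the square of the idempotent
  \<open>x'''x''\<close>.\<close>

lemma i_i_i_mult_i_i: "i (i (i x)) \<cdot> i (i x) = i (i (i x)) \<cdot> x"
  by (metis i_mult_idem i_regular twisted_assoc)

lemma i_mult_commute: "(i x \<cdot> x) \<cdot> (i y \<cdot> y) = (i y \<cdot> y) \<cdot> (i x \<cdot> x)"
  by (metis commute i_mult_i_i)

lemma i_i_i_expand: "i (i (i x)) = (i (i (i x)) \<cdot> x) \<cdot> i x"
  by (metis i_i_regular i_i_i_mult_i_i)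

text \<open>\<open>x'''x = x'''x''\<close> has the form \<open>y'y\<close> with
  \<open>y = x''\<close>, so it commutes with \<open>x'x\<close>, which it absorbs on the
  right.\<close>

lemma i_mult_absorb: "(i x \<cdot> x) \<cdot> (i (i (i x)) \<cdot> x) = i (i (i x)) \<cdot> x"
proof -
  have "(i (i (i x)) \<cdot> x) \<cdot> (i x \<cdot> x) = i (i (i x)) \<cdot> x"
    by (metis i_i_i_expand mult_i_mult)
  then show ?thesis
    by (metis i_mult_commute i_i_i_mult_i_i)
qed

lemma i_i_i: "i (i (i x)) = i x"
proof -
  \<comment> \<open>\<open>x''' = ((x'x)(x'''x))x' = (x'x)((x'''x'')x''')\<close>, the twist turning
    the last \<open>x'\<close> into \<open>x'''\<close>.\<close>
  have "i (i (i x)) = (i x \<cdot> x) \<cdot> i (i (i x))"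
    by (metis i_mult_absorb i_i_i_expand i_i_i_mult_i_i i_i_regular mult_i_mult twisted_assoc)
  then show ?thesis
    by (metis i_mult_idem i_regular twisted_assoc)
qed

text \<open>Since \<open>y'''' = y''\<close>, \<open>twisted_assoc\<close> gives
  \<open>(uv)y = (uv)y''\<close>, and by regularity every \<open>x\<close> is a product
  \<open>uv\<close>.\<close>

lemma mult_i_i: "x \<cdot> i (i y) = x \<cdot> y"
  by (metis i_i_i regular twisted_assoc)

sublocale semigroup f
  by unfold_locales (simp add: twisted_assoc mult_i_i)

lemma i_i: "i (i x) = x"
proof -
  \<comment> \<open>The elements \<open>xx'\<close> and \<open>x''x'\<close> commute, and their
    product is \<open>xx'\<close> in one order and \<open>x''x'\<close> in the other.\<close>
  have "x \<cdot> i x = i (i x) \<cdot> i x"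
    by (metis commute i_i_i assoc mult_i_i i_mult_i_i regular i_regular)
  then show ?thesis
    by (metis regular i_i_regular)
qed

lemma inverse_pair_i: "inverse_pair f x (i x)"
  by (simp add: inverse_pair_def regular i_regular)

lemma idempotent_eq:
  assumes e: "e \<cdot> e = e"
  shows "e = e \<cdot> i e"
proof -
  have "i e = (i e \<cdot> e) \<cdot> (e \<cdot> i e)"
    by (metis assoc e i_regular)
  also have "\<dots> = (e \<cdot> i e) \<cdot> (i e \<cdot> e)"
    by (rule commute [symmetric])
  finally have ie: "i e = (e \<cdot> i e) \<cdot> (i e \<cdot> e)" .
  \<comment> \<open>By \<open>ie\<close>, \<open>e'\<close> starts and ends with \<open>e\<close>,
    so \<open>e\<close> fixes it from either side.\<close>
  have "e \<cdot> i e = i e" by (metis ie assoc e)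
  moreover have "i e \<cdot> e = i e" by (metis ie assoc e)
  ultimately show ?thesis by (metis regular)
qed

lemma idempotents_commute:
  assumes "e \<cdot> e = e" and "g \<cdot> g = g"
  shows "e \<cdot> g = g \<cdot> e"
  \<comment> \<open>As \<open>gg' = g''g'\<close>, the identity \<open>commute\<close> applies with
    \<open>y = g'\<close>.\<close>
  by (metis assms commute i_i idempotent_eq)

sublocale inverse_semigroup f
  by unfold_locales
    (blast intro: inverse_pair_i inverse_unique_if_idempotents_commute idempotents_commute)

lemma i_eq_inversion: "i x = semigroup_inversion f x"
  by (rule inverse_pair_unique [OF inverse_pair_i inverse_pair_inversion])

end

theorem mainTheorem1:
  fixes f :: "'a \<Rightarrow> 'a \<Rightarrow> 'a" (infixl "\<cdot>" 70)
    and i :: "'a \<Rightarrow> 'a"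
  shows "(inverse_semigroup f \<and> (\<forall>x. i x = semigroup_inversion f x)) \<longleftrightarrow>
    (\<forall>x y z.
      x = (x \<cdot> i x) \<cdot> x \<and>
      (x \<cdot> i x) \<cdot> (i y \<cdot> y) = (i y \<cdot> y) \<cdot> (x \<cdot> i x) \<and>
      (x \<cdot> y) \<cdot> z = x \<cdot> (y \<cdot> i (i z)))"
    (is "?inverse \<longleftrightarrow> ?identities")
proof
  assume inv: ?inverse
  then interpret inverse_semigroup f by simp
  have i: "i = semigroup_inversion f" using inv by auto
  have pair: "(x \<cdot> i x) \<cdot> x = x" "(i x \<cdot> x) \<cdot> i x = i x" for x
    using inverse_pair_inversion [of x] by (simp_all add: inverse_pair_def i)
  have "(x \<cdot> i x) \<cdot> (i y \<cdot> y) = (i y \<cdot> y) \<cdot> (x \<cdot> i x)" for x y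
    by (rule idempotents_commute) (metis assoc pair)+
  then show ?identities
    by (simp add: pair) (simp add: i inversion_inversion assoc)
next
  assume ids: ?identities
  then interpret inversion_identities f i
    by unfold_locales metis+
  show ?inverse
    using inverse_semigroup_axioms i_eq_inversion by blast
qed

end
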